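(* Let $D$ be an integral domain with quotient field $K$ and let $T$ be an overring of $D$. The following properties are equivalent: (i) $\wedge_{\{T\}}\in\mathrm{SStar}_{f,eab}(D)$; (ii) $\wedge_{\{T\}}=b(T)$; (iii) $T$ is a Prüfer domain.
   Context: An overring of $D$ is a ring $T$ with $D\subseteq T\subseteq K$. $\overline{\mathbf F}(D)$ is the set of nonzero $D$-submodules of $K$, $\mathbf f(D)$ the set of nonzero finitely generated fractional ideals of $D$. A semistar operation on $D$ is a map $\star:\overline{\mathbf F}(D)\to\overline{\mathbf F}(D)$, $E\mapsto E^\star$, such that for all $0\ne z\in K$ and $E,F\in\overline{\mathbf F}(D)$: $(zE)^\star=zE^\star$; $E\subseteq F\Rightarrow E^\star\subseteq F^\star$; $E\subseteq E^\star$; $(E^\star)^\star=E^\star$. It is of finite type if $E^\star=\bigcup\{F^\star\mid F\subseteq E,F\in\mathbf f(D)\}$ for all $E\in\overline{\mathbf F}(D)$, and eab if for all $F,G,H\in\mathbf f(D)$, $(FG)^\star\subseteq(FH)^\star$ implies $G^\star\subseteq H^\star$. $\mathrm{SStar}_{f,eab}(D)$ is the set of eab semistar operations of finite type on $D$. For an overring $T$, $\wedge_{\{T\}}$ is the semistar operation $E\mapsto ET$, and $b(T)$ is the semistar operation $E\mapsto\bigcap\{EV\mid V\in\mathrm{Zar}(T)\}$, where $\mathrm{Zar}(T)$ is the set of valuation overrings of $T$ (valuation domains $V$ with $T\subseteq V\subseteq K$, including $K$). *)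

theory Defs
  imports "HOL-Algebra.Algebra"
begin

text \<open>
  A domain \<open>D\<close> is given as a subdomain of its quotient field \<open>K\<close>. The product of two submodules of
  \<open>K\<close> (finite sums of products of elements) is \<^const>\<open>ideal_prod\<close> taken in \<open>K\<close>, and the dilation
  \<open>z E\<close> is the left coset \<open>z <#\<^bsub>K\<^esub> E\<close>.
\<close>

definition quotient_field :: "('a, 'b) ring_scheme \<Rightarrow> 'a set \<Rightarrow> bool" where
  "quotient_field K D \<longleftrightarrow> field K \<and> subdomain D K \<and>
     (\<forall>x\<in>carrier K. \<exists>a\<in>D. \<exists>b\<in>D - {\<zero>\<^bsub>K\<^esub>}. x = a \<otimes>\<^bsub>K\<^esub> inv\<^bsub>K\<^esub> b)"

definition overring :: "('a, 'b) ring_scheme \<Rightarrow> 'a set \<Rightarrow> 'a set \<Rightarrow> bool" where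
  "overring K D T \<longleftrightarrow> subring T K \<and> D \<subseteq> T"

text \<open>
  The locale \<^locale>\<open>subalgebra\<close> says that \<open>E\<close> is an additive subgroup of \<open>K\<close> closed under
  multiplication by elements of \<open>D\<close>; it does not ask for closure under products, so
  \<open>subalgebra D E K\<close> means that \<open>E\<close> is a \<open>D\<close>-submodule of \<open>K\<close>.
\<close>

definition nonzero_submodules :: "('a, 'b) ring_scheme \<Rightarrow> 'a set \<Rightarrow> 'a set set" where
  "nonzero_submodules K D = {E. subalgebra D E K \<and> E \<noteq> {\<zero>\<^bsub>K\<^esub>}}"

definition fractional_ideal :: "('a, 'b) ring_scheme \<Rightarrow> 'a set \<Rightarrow> 'a set \<Rightarrow> bool" where
  "fractional_ideal K D E \<longleftrightarrow>
     subalgebra D E K \<and> (\<exists>d\<in>D - {\<zero>\<^bsub>K\<^esub>}. d <#\<^bsub>K\<^esub> E \<subseteq> D)"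

definition fg_submodule :: "('a, 'b) ring_scheme \<Rightarrow> 'a set \<Rightarrow> 'a set \<Rightarrow> bool" where
  "fg_submodule K D E \<longleftrightarrow>
     (\<exists>S. finite S \<and> S \<subseteq> carrier K \<and> E = (\<lambda>M. subalgebra D M K) hull S)"

definition fg_fractional_ideals :: "('a, 'b) ring_scheme \<Rightarrow> 'a set \<Rightarrow> 'a set set" where
  "fg_fractional_ideals K D =
     {E. fractional_ideal K D E \<and> fg_submodule K D E \<and> E \<noteq> {\<zero>\<^bsub>K\<^esub>}}"

text \<open>
  Semistar operations are extensional functions on the nonzero submodules (undefined elsewhere),
  so that equality of functions is equality of semistar operations.
\<close>

definition semistar_operation ::
    "('a, 'b) ring_scheme \<Rightarrow> 'a set \<Rightarrow> ('a set \<Rightarrow> 'a set) \<Rightarrow> bool" where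
  "semistar_operation K D star \<longleftrightarrow>
     star \<in> nonzero_submodules K D \<rightarrow>\<^sub>E nonzero_submodules K D \<and>
     (\<forall>z\<in>carrier K - {\<zero>\<^bsub>K\<^esub>}. \<forall>E\<in>nonzero_submodules K D.
        star (z <#\<^bsub>K\<^esub> E) = z <#\<^bsub>K\<^esub> star E) \<and>
     (\<forall>E\<in>nonzero_submodules K D. \<forall>F\<in>nonzero_submodules K D. E \<subseteq> F \<longrightarrow> star E \<subseteq> star F) \<and>
     (\<forall>E\<in>nonzero_submodules K D. E \<subseteq> star E) \<and>
     (\<forall>E\<in>nonzero_submodules K D. star (star E) = star E)"

definition finite_type ::
    "('a, 'b) ring_scheme \<Rightarrow> 'a set \<Rightarrow> ('a set \<Rightarrow> 'a set) \<Rightarrow> bool" where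
  "finite_type K D star \<longleftrightarrow>
     (\<forall>E\<in>nonzero_submodules K D.
        star E = \<Union>{star F | F. F \<subseteq> E \<and> F \<in> fg_fractional_ideals K D})"

definition eab :: "('a, 'b) ring_scheme \<Rightarrow> 'a set \<Rightarrow> ('a set \<Rightarrow> 'a set) \<Rightarrow> bool" where
  "eab K D star \<longleftrightarrow>
     (\<forall>F\<in>fg_fractional_ideals K D. \<forall>G\<in>fg_fractional_ideals K D. \<forall>H\<in>fg_fractional_ideals K D.
        star (F \<cdot>\<^bsub>K\<^esub> G) \<subseteq> star (F \<cdot>\<^bsub>K\<^esub> H) \<longrightarrow> star G \<subseteq> star H)"

definition SStar_f_eab :: "('a, 'b) ring_scheme \<Rightarrow> 'a set \<Rightarrow> ('a set \<Rightarrow> 'a set) set" where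
  "SStar_f_eab K D = {star. semistar_operation K D star \<and> finite_type K D star \<and> eab K D star}"

definition wedge_overring ::
    "('a, 'b) ring_scheme \<Rightarrow> 'a set \<Rightarrow> 'a set \<Rightarrow> ('a set \<Rightarrow> 'a set)" where
  "wedge_overring K D T = (\<lambda>E\<in>nonzero_submodules K D. E \<cdot>\<^bsub>K\<^esub> T)"

definition valuation_domain :: "('a, 'b) ring_scheme \<Rightarrow> 'a set \<Rightarrow> bool" where
  "valuation_domain K V \<longleftrightarrow>
     subdomain V K \<and> (\<forall>x\<in>carrier K - {\<zero>\<^bsub>K\<^esub>}. x \<in> V \<or> inv\<^bsub>K\<^esub> x \<in> V)"

definition Zar :: "('a, 'b) ring_scheme \<Rightarrow> 'a set \<Rightarrow> 'a set set" where
  "Zar K T = {V. overring K T V \<and> valuation_domain K V}"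

definition b_operation ::
    "('a, 'b) ring_scheme \<Rightarrow> 'a set \<Rightarrow> 'a set \<Rightarrow> ('a set \<Rightarrow> 'a set)" where
  "b_operation K D T = (\<lambda>E\<in>nonzero_submodules K D. \<Inter>{E \<cdot>\<^bsub>K\<^esub> V | V. V \<in> Zar K T})"

definition invertible_ideal :: "('a, 'b) ring_scheme \<Rightarrow> 'a set \<Rightarrow> 'a set \<Rightarrow> bool" where
  "invertible_ideal K T I \<longleftrightarrow> (\<exists>J. fractional_ideal K T J \<and> I \<cdot>\<^bsub>K\<^esub> J = T)"

definition prufer_domain :: "('a, 'b) ring_scheme \<Rightarrow> 'a set \<Rightarrow> bool" where
  "prufer_domain K T \<longleftrightarrow> quotient_field K T \<and>
     (\<forall>S. finite S \<longrightarrow> S \<subseteq> T \<longrightarrow> Idl\<^bsub>K\<lparr>carrier := T\<rparr>\<^esub> S \<noteq> {\<zero>\<^bsub>K\<^esub>} \<longrightarrow>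
        invertible_ideal K T (Idl\<^bsub>K\<lparr>carrier := T\<rparr>\<^esub> S))"

end

theory Submission
  imports Defs
begin

text \<open>
  All three conditions are compared with one elementary condition, \<open>pairs_invertible\<close>: for every
  \<open>x\<close> in the quotient field, the fractional ideal \<open>T + T x\<close> is invertible.

  If \<open>E \<mapsto> E T\<close> is eab, then finitely generated factors can be cancelled from inclusions after
  extension to \<open>T\<close>. Since \<open>(1, x) (x) \<subseteq> (1, x) (1, x\<^sup>2)\<close>, cancelling \<open>(1, x)\<close> gives
  \<open>x = s + r x\<^sup>2\<close> with \<open>s, r \<in> T\<close>. The element \<open>v = r x\<close> then satisfies \<open>v\<^sup>2 = v - r s\<close>, so
  \<open>(1, v) (v) \<subseteq> (1, v) T\<close>, and cancelling \<open>(1, v)\<close> gives \<open>v \<in> T\<close>. Now \<open>1 - v\<close> and \<open>r\<close> lie in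
  \<open>T\<close>, their products with \<open>x\<close> are \<open>s\<close> and \<open>v\<close>, and \<open>1 = (1 - v) + r x\<close>, so they generate the
  inverse of \<open>T + T x\<close> (\<open>eab_imp_pairs_invertible\<close>).

  Conversely, if all the \<open>T + T x\<close> are invertible, then the localization of \<open>T\<close> at any maximal
  ideal is a valuation domain: in \<open>1 = u + r y\<close> one summand is a unit of the localization, and it
  serves as the denominator of \<open>y\<close> or of \<open>1/y\<close>. Localizing at a maximal ideal that contains
  \<open>{t \<in> T. t x \<in> E}\<close> shows that a \<open>T\<close>-module \<open>E\<close> not containing \<open>x\<close> is separated from \<open>x\<close> by
  some \<open>E V\<close> (\<open>exists_valuation_overring_avoiding\<close>). Taking \<open>E T\<close> for the module yields
  \<open>E T = \<Inter> E V\<close>, which is the equality with the b-operation; taking \<open>I (T : I)\<close> and \<open>x = 1\<close>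
  yields the invertibility of every finitely generated ideal \<open>I\<close>, because \<open>I\<close> becomes principal
  in \<open>V\<close>.

  Two implications close the circle. The b-operation is always eab, since finitely generated
  ideals extend to principal ideals in valuation overrings (\<open>eab_b_operation\<close>), while
  \<open>E \<mapsto> E T\<close> is always a semistar operation of finite type. In a Pruefer domain
  \<open>T + T x\<close> is invertible because it is a multiple of the ideal generated by a numerator and a
  denominator of \<open>x\<close>.
\<close>

section \<open>Submodules of a field\<close>

lemma subalgebraE:
  assumes "subalgebra T E R"
  shows "E \<subseteq> carrier R" "\<zero>\<^bsub>R\<^esub> \<in> E"
    "\<And>a b. a \<in> E \<Longrightarrow> b \<in> E \<Longrightarrow> a \<oplus>\<^bsub>R\<^esub> b \<in> E"
    "\<And>t a. t \<in> T \<Longrightarrow> a \<in> E \<Longrightarrow> t \<otimes>\<^bsub>R\<^esub> a \<in> E"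
proof -
  interpret subalgebra T E R by fact
  show "E \<subseteq> carrier R" "\<zero>\<^bsub>R\<^esub> \<in> E"
    "\<And>a b. a \<in> E \<Longrightarrow> b \<in> E \<Longrightarrow> a \<oplus>\<^bsub>R\<^esub> b \<in> E"
    using subset one_closed m_closed by auto
  show "\<And>t a. t \<in> T \<Longrightarrow> a \<in> E \<Longrightarrow> t \<otimes>\<^bsub>R\<^esub> a \<in> E"
    using smult_closed by auto
qed

lemma subalgebra_mono: "subalgebra T E R \<Longrightarrow> D \<subseteq> T \<Longrightarrow> subalgebra D E R"
  unfolding subalgebra_def subalgebra_axioms_def by blast

lemma ideal_prod_subsetI:
  assumes "\<And>i j. i \<in> I \<Longrightarrow> j \<in> J \<Longrightarrow> i \<otimes>\<^bsub>R\<^esub> j \<in> M"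
    and "\<And>a b. a \<in> M \<Longrightarrow> b \<in> M \<Longrightarrow> a \<oplus>\<^bsub>R\<^esub> b \<in> M"
  shows "I \<cdot>\<^bsub>R\<^esub> J \<subseteq> M"
proof
  fix x assume "x \<in> I \<cdot>\<^bsub>R\<^esub> J"
  then show "x \<in> M" by induction (use assms in auto)
qed

lemma ideal_prod_mono:
  assumes "I \<subseteq> I'" "J \<subseteq> J'"
  shows "I \<cdot>\<^bsub>R\<^esub> J \<subseteq> I' \<cdot>\<^bsub>R\<^esub> J'"
  using assms by (intro ideal_prod_subsetI) (auto intro: ideal_prod.intros)

text \<open>The residual module \<open>(M : A)\<close>.\<close>
definition colon :: "('a, 'b) ring_scheme \<Rightarrow> 'a set \<Rightarrow> 'a set \<Rightarrow> 'a set" where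
  "colon R M A = {x \<in> carrier R. \<forall>a\<in>A. x \<otimes>\<^bsub>R\<^esub> a \<in> M}"

abbreviation gen_submodule :: "('a, 'b) ring_scheme \<Rightarrow> 'a set \<Rightarrow> 'a set \<Rightarrow> 'a set" where
  "gen_submodule R T S \<equiv> (\<lambda>M. subalgebra T M R) hull S"

context field
begin

lemma subalgebraI:
  assumes T: "subring T R" and E: "E \<subseteq> carrier R" "\<zero> \<in> E"
    and add: "\<And>a b. a \<in> E \<Longrightarrow> b \<in> E \<Longrightarrow> a \<oplus> b \<in> E"
    and smult: "\<And>t a. t \<in> T \<Longrightarrow> a \<in> E \<Longrightarrow> t \<otimes> a \<in> E"
  shows "subalgebra T E R"
proof (intro subalgebra.intro subalgebra_axioms.intro add.subgroupI)
  fix a assume a: "a \<in> E"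
  have "\<ominus> \<one> \<otimes> a \<in> E" using smult[OF subringE(5)[OF T subringE(3)[OF T]] a] .
  then show "\<ominus> a \<in> E" using a E by (simp add: subset_iff l_minus)
qed (use assms in auto)

lemma subalgebra_self: "subring T R \<Longrightarrow> subalgebra T T R"
  using subringE[of T R] by (intro subalgebraI) auto

lemma subalgebra_colon:
  assumes T: "subring T R" and M: "subalgebra T M R" and A: "A \<subseteq> carrier R"
  shows "subalgebra T (colon R M A) R"
proof -
  have Tc: "T \<subseteq> carrier R" using subringE(1)[OF T] .
  show ?thesis
  proof (rule subalgebraI[OF T])
    fix a b assume "a \<in> colon R M A" "b \<in> colon R M A"
    then show "a \<oplus> b \<in> colon R M A"
      using subalgebraE[OF M] A by (auto simp: colon_def l_distr subset_iff)
  next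
    fix t a assume "t \<in> T" "a \<in> colon R M A"
    then show "t \<otimes> a \<in> colon R M A"
      using subalgebraE[OF M] A Tc by (auto simp: colon_def m_assoc subset_iff)
  qed (use subalgebraE[OF M] A in \<open>auto simp: colon_def subset_iff\<close>)
qed

lemma subalgebra_ideal_prod:
  assumes T: "subring T R" and I: "I \<subseteq> carrier R" "I \<noteq> {}" and J: "subalgebra T J R"
  shows "subalgebra T (I \<cdot> J) R"
proof (rule subalgebraI[OF T])
  have Tc: "T \<subseteq> carrier R" using subringE(1)[OF T] .
  show sub: "I \<cdot> J \<subseteq> carrier R"
    using I subalgebraE(1)[OF J] by (intro ideal_prod_subsetI) auto
  obtain i where "i \<in> I" using I by auto
  then show "\<zero> \<in> I \<cdot> J"
    using ideal_prod.prod[of i I \<zero> J R] subalgebraE(2)[OF J] I by (auto simp: subset_iff)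
  show "t \<otimes> a \<in> I \<cdot> J" if t: "t \<in> T" and "a \<in> I \<cdot> J" for t a
    using that(2)
  proof induction
    case (prod i j)
    then have "i \<otimes> (t \<otimes> j) \<in> I \<cdot> J"
      using subalgebraE(4)[OF J t] by (intro ideal_prod.prod)
    moreover have "i \<otimes> (t \<otimes> j) = t \<otimes> (i \<otimes> j)"
      using prod t Tc I subalgebraE(1)[OF J] by (intro m_lcomm) auto
    ultimately show ?case by simp
  next
    case (sum a b)
    then show ?case using sub t Tc by (auto simp: r_distr subset_iff intro: ideal_prod.sum)
  qed
qed (auto intro: ideal_prod.sum)

lemma subalgebra_gen_submodule:
  assumes T: "subring T R" and S: "S \<subseteq> carrier R"
  shows "subalgebra T (gen_submodule R T S) R"
proof -
  have c: "subalgebra T (carrier R) R"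
    using subringE(1)[OF T] by (rule carrier_is_subalgebra)
  show ?thesis
  proof (rule subalgebraI[OF T])
    show "gen_submodule R T S \<subseteq> carrier R" using S c by (rule hull_minimal)
  qed (auto simp: hull_def dest: subalgebraE)
qed

text \<open>
  Products of generators decide where the product of two modules lies: the elements that multiply
  a given set into \<open>M\<close> form a residual, hence a module, so one factor at a time can be replaced by
  the module it generates.
\<close>
lemma gen_submodule_prod_subset:
  assumes T: "subring T R" and M: "subalgebra T M R"
    and S: "S \<subseteq> carrier R" and S': "S' \<subseteq> carrier R"
    and SM: "\<And>a b. a \<in> S \<Longrightarrow> b \<in> S' \<Longrightarrow> a \<otimes> b \<in> M"
  shows "gen_submodule R T S \<cdot> gen_submodule R T S' \<subseteq> M"
proof -
  have "gen_submodule R T S \<subseteq> colon R M S'"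
    using SM S by (intro hull_minimal subalgebra_colon[OF T M S']) (auto simp: colon_def)
  then have 1: "a \<otimes> b \<in> M" if "a \<in> gen_submodule R T S" "b \<in> S'" for a b
    using that by (auto simp: colon_def)
  have c: "gen_submodule R T S \<subseteq> carrier R"
    using subalgebraE(1)[OF subalgebra_gen_submodule[OF T S]] .
  have "gen_submodule R T S' \<subseteq> colon R M (gen_submodule R T S)"
  proof (intro hull_minimal subalgebra_colon[OF T M c] subsetI)
    fix b assume "b \<in> S'"
    then show "b \<in> colon R M (gen_submodule R T S)"
      using 1 c S' by (auto simp: colon_def m_comm subset_iff)
  qed
  then have "b \<otimes> a \<in> M" if "a \<in> gen_submodule R T S" "b \<in> gen_submodule R T S'" for a b
    using that by (auto simp: colon_def)
  then show ?thesis
    using c subalgebraE(1)[OF subalgebra_gen_submodule[OF T S']] subalgebraE(3)[OF M]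
    by (intro ideal_prod_subsetI) (auto simp: m_comm subset_iff)
qed

text \<open>
  This is the product of \<open>J\<close> with the module generated by \<open>a\<close> and \<open>b\<close>, with its elements written
  out.
\<close>
lemma subalgebra_two_gen:
  assumes T: "subring T R" and J: "subalgebra T J R" and ab: "a \<in> carrier R" "b \<in> carrier R"
  shows "subalgebra T {a \<otimes> p \<oplus> b \<otimes> q | p q. p \<in> J \<and> q \<in> J} R" (is "subalgebra T ?N R")
proof (rule subalgebraI[OF T])
  have Tc: "T \<subseteq> carrier R" and Jc: "J \<subseteq> carrier R"
    using subringE(1)[OF T] subalgebraE(1)[OF J] by auto
  show "?N \<subseteq> carrier R" using Jc ab by auto
  show "\<zero> \<in> ?N" using subalgebraE(2)[OF J] ab by force
  fix x assume "x \<in> ?N"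
  then obtain p q where pq: "x = a \<otimes> p \<oplus> b \<otimes> q" "p \<in> J" "q \<in> J" by auto
  then have pqc: "p \<in> carrier R" "q \<in> carrier R" using Jc by auto
  show "x \<oplus> y \<in> ?N" if y: "y \<in> ?N" for y
  proof -
    obtain p' q' where pq': "y = a \<otimes> p' \<oplus> b \<otimes> q'" "p' \<in> J" "q' \<in> J" using y by auto
    then have "p' \<in> carrier R" "q' \<in> carrier R" using Jc by auto
    then have "x \<oplus> y = a \<otimes> (p \<oplus> p') \<oplus> b \<otimes> (q \<oplus> q')"
      using pq(1) pq'(1) pqc ab by (simp add: r_distr a_ac)
    then show ?thesis using subalgebraE(3)[OF J] pq pq' by blast
  qed
  show "t \<otimes> x \<in> ?N" if t: "t \<in> T" for t
  proof -
    have "t \<otimes> x = a \<otimes> (t \<otimes> p) \<oplus> b \<otimes> (t \<otimes> q)"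
      using pq(1) pqc ab t Tc by (simp add: r_distr m_ac subset_iff)
    then show ?thesis using subalgebraE(4)[OF J t] pq by blast
  qed
qed

lemma inv_nonzero: "x \<in> carrier R \<Longrightarrow> x \<noteq> \<zero> \<Longrightarrow> inv x \<in> carrier R \<and> x \<otimes> inv x = \<one> \<and> inv x \<otimes> x = \<one> \<and> inv x \<noteq> \<zero>"
  using field_Units by (metis Diff_iff Units_inv_closed Units_l_inv Units_r_inv l_null singleton_iff zero_not_one)

section \<open>Finitely generated fractional ideals\<close>

lemma common_denominator:
  assumes D: "quotient_field R D" and "finite S" "S \<subseteq> carrier R"
  shows "\<exists>d\<in>D - {\<zero>}. \<forall>s\<in>S. d \<otimes> s \<in> D"
  using assms(2,3)
proof induction
  case empty
  then show ?case
    using D subdomainE(3)[of D R] by (intro bexI[of _ \<one>]) (auto simp: quotient_field_def)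
next
  case (insert x S)
  have sub: "subdomain D R" using D by (simp add: quotient_field_def)
  note Dc = subdomainE(1)[OF sub] subdomainE(6)[OF sub]
  obtain d where d: "d \<in> D" "d \<noteq> \<zero>" "\<forall>s\<in>S. d \<otimes> s \<in> D" using insert by auto
  obtain a b where ab: "a \<in> D" "b \<in> D" "b \<noteq> \<zero>" "x = a \<otimes> inv b"
    using D insert.prems unfolding quotient_field_def by blast
  have c: "a \<in> carrier R" "b \<in> carrier R" "d \<in> carrier R" using ab d Dc by auto
  have "b \<otimes> x = a" using ab c inv_nonzero[of b] by (simp add: m_lcomm[of b a])
  then have "(d \<otimes> b) \<otimes> x = d \<otimes> a" using c insert.prems by (simp add: m_assoc)
  moreover have "(d \<otimes> b) \<otimes> s = b \<otimes> (d \<otimes> s)" if "s \<in> S" for s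
    using that c insert.prems by (simp add: m_ac subset_iff)
  moreover have "d \<otimes> b \<in> D - {\<zero>}" using d ab c Dc integral by blast
  ultimately show ?case
    using d ab Dc by (intro bexI[of _ "d \<otimes> b"]) auto
qed

lemma gen_submodule_fg_fractional_ideal:
  assumes D: "quotient_field R D" and S: "finite S" "S \<subseteq> carrier R" "\<not> S \<subseteq> {\<zero>}"
  shows "gen_submodule R D S \<in> fg_fractional_ideals R D"
proof -
  have sub: "subring D R" using D by (simp add: quotient_field_def subdomain_def subcring_def)
  note Dc = subringE(1)[OF sub]
  have mod: "subalgebra D (gen_submodule R D S) R" by (rule subalgebra_gen_submodule[OF sub S(2)])
  obtain d where d: "d \<in> D" "d \<noteq> \<zero>" "\<forall>s\<in>S. d \<otimes> s \<in> D"
    using common_denominator[OF D S(1,2)] by auto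
  have dc: "d \<in> carrier R" using d Dc by auto
  have "gen_submodule R D S \<subseteq> colon R D {d}"
    using d dc S by (intro hull_minimal subalgebra_colon sub subalgebra_self)
      (auto simp: colon_def m_comm subset_iff)
  then have "d <# gen_submodule R D S \<subseteq> D"
    using dc by (auto simp: l_coset_def colon_def m_comm)
  then have "fractional_ideal R D (gen_submodule R D S)"
    using mod d by (auto simp: fractional_ideal_def)
  moreover have "gen_submodule R D S \<noteq> {\<zero>}" using S(3) hull_subset[of S] by blast
  ultimately show ?thesis
    using S by (auto simp: fg_fractional_ideals_def fg_submodule_def)
qed

lemma fg_fractional_idealE:
  assumes D: "subring D R" and F: "F \<in> fg_fractional_ideals R D"
  obtains S where "finite S" "S \<subseteq> carrier R" "\<not> S \<subseteq> {\<zero>}" "F = gen_submodule R D S"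
proof -
  obtain S where S: "finite S" "S \<subseteq> carrier R" "F = gen_submodule R D S" and F0: "F \<noteq> {\<zero>}"
    using F by (auto simp: fg_fractional_ideals_def fg_submodule_def)
  have z: "subalgebra D {\<zero>} R" using subringE(1)[OF D] by (intro subalgebraI[OF D]) auto
  have "\<zero> \<in> F" using subalgebraE(2)[OF subalgebra_gen_submodule[OF D S(2)]] S(3) by simp
  then have "\<not> S \<subseteq> {\<zero>}" using hull_minimal[of S "{\<zero>}" "\<lambda>M. subalgebra D M R"] z S(3) F0 by blast
  with S show ?thesis using that by blast
qed

lemma fg_fractional_ideal_nonzero_submodule:
  "F \<in> fg_fractional_ideals R D \<Longrightarrow> F \<in> nonzero_submodules R D"
  by (auto simp: fg_fractional_ideals_def nonzero_submodules_def fractional_ideal_def)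

lemma nonzero_submodulesE:
  assumes "E \<in> nonzero_submodules R D"
  shows "subalgebra D E R" "E \<subseteq> carrier R" "\<exists>e\<in>E. e \<noteq> \<zero>"
  using assms subalgebraE[of D E R] by (auto simp: nonzero_submodules_def)

lemma nonzero_submodules_prod:
  assumes D: "subring D R" and E: "E \<in> nonzero_submodules R D" and F: "F \<in> nonzero_submodules R D"
  shows "E \<cdot> F \<in> nonzero_submodules R D"
proof -
  note EE = nonzero_submodulesE[OF E] and FF = nonzero_submodulesE[OF F]
  obtain e f where ef: "e \<in> E" "e \<noteq> \<zero>" "f \<in> F" "f \<noteq> \<zero>" using EE FF by auto
  then have "e \<otimes> f \<in> E \<cdot> F" "e \<otimes> f \<noteq> \<zero>"
    using EE FF integral by (auto intro: ideal_prod.prod)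
  moreover have "subalgebra D (E \<cdot> F) R"
    using EE ef by (intro subalgebra_ideal_prod[OF D _ _ FF(1)]) auto
  ultimately show ?thesis by (auto simp: nonzero_submodules_def)
qed

section \<open>Extension of submodules to an overring\<close>

lemma subset_extension:
  assumes T: "subring T R" and E: "E \<subseteq> carrier R"
  shows "E \<subseteq> E \<cdot> T"
proof
  fix x assume "x \<in> E"
  then show "x \<in> E \<cdot> T"
    using ideal_prod.prod[of x E \<one> T R] subringE(3)[OF T] E by (auto simp: subset_iff)
qed

lemma extension_subsetI:
  assumes T: "subring T R" and N: "subalgebra T N R" and EN: "E \<subseteq> N"
  shows "E \<cdot> T \<subseteq> N"
proof (rule ideal_prod_subsetI)
  fix i j assume ij: "i \<in> E" "j \<in> T"
  then have "i \<otimes> j = j \<otimes> i"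
    using subringE(1)[OF T] subalgebraE(1)[OF N] EN by (intro m_comm) auto
  then show "i \<otimes> j \<in> N" using subalgebraE(4)[OF N] ij EN by auto
qed (rule subalgebraE(3)[OF N])

lemma l_coset_extension:
  assumes z: "z \<in> carrier R" and T: "T \<subseteq> carrier R" and E: "E \<subseteq> carrier R"
  shows "(z <# E) \<cdot> T = z <# (E \<cdot> T)"
proof
  have sub: "E \<cdot> T \<subseteq> carrier R" using T E by (intro ideal_prod_subsetI) auto
  show "(z <# E) \<cdot> T \<subseteq> z <# (E \<cdot> T)"
  proof (rule ideal_prod_subsetI)
    fix i j assume "i \<in> z <# E" "j \<in> T"
    then obtain e where e: "e \<in> E" "i = z \<otimes> e" by (auto simp: l_coset_def)
    then have "i \<otimes> j = z \<otimes> (e \<otimes> j)" using \<open>j \<in> T\<close> z T E by (auto simp: m_assoc subset_iff)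
    then show "i \<otimes> j \<in> z <# (E \<cdot> T)"
      using e \<open>j \<in> T\<close> by (auto simp: l_coset_def intro: ideal_prod.prod)
  next
    fix a b assume "a \<in> z <# (E \<cdot> T)" "b \<in> z <# (E \<cdot> T)"
    then obtain p q where pq: "p \<in> E \<cdot> T" "q \<in> E \<cdot> T" "a = z \<otimes> p" "b = z \<otimes> q"
      by (auto simp: l_coset_def)
    then have "a \<oplus> b = z \<otimes> (p \<oplus> q)" using sub z by (simp add: r_distr subset_iff)
    then show "a \<oplus> b \<in> z <# (E \<cdot> T)" using pq by (auto simp: l_coset_def intro: ideal_prod.sum)
  qed
  have "z \<otimes> h \<in> (z <# E) \<cdot> T" if "h \<in> E \<cdot> T" for h
    using that
  proof induction
    case (prod i j)
    then have "(z \<otimes> i) \<otimes> j \<in> (z <# E) \<cdot> T"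
      by (intro ideal_prod.prod) (auto simp: l_coset_def)
    then show ?case using prod z T E by (simp add: m_assoc subset_iff)
  next
    case (sum a b)
    then show ?case using sub z by (auto simp: r_distr subset_iff intro: ideal_prod.sum)
  qed
  then show "z <# (E \<cdot> T) \<subseteq> (z <# E) \<cdot> T" by (auto simp: l_coset_def)
qed

lemma nonzero_submodules_l_coset:
  assumes D: "subring D R" and E: "E \<in> nonzero_submodules R D" and z: "z \<in> carrier R - {\<zero>}"
  shows "z <# E \<in> nonzero_submodules R D"
proof -
  note EE = nonzero_submodulesE[OF E]
  note Dc = subringE(1)[OF D]
  have "subalgebra D (z <# E) R"
  proof (rule subalgebraI[OF D])
    show "z <# E \<subseteq> carrier R" using EE z by (auto simp: l_coset_def)
    show "\<zero> \<in> z <# E" using subalgebraE(2)[OF EE(1)] z by (force simp: l_coset_def)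
  next
    fix a b assume "a \<in> z <# E" "b \<in> z <# E"
    then obtain p q where pq: "p \<in> E" "q \<in> E" "a = z \<otimes> p" "b = z \<otimes> q"
      by (auto simp: l_coset_def)
    then have "a \<oplus> b = z \<otimes> (p \<oplus> q)" using EE z by (simp add: r_distr subset_iff)
    then show "a \<oplus> b \<in> z <# E"
      using pq subalgebraE(3)[OF EE(1)] by (auto simp: l_coset_def)
  next
    fix t a assume t: "t \<in> D" and "a \<in> z <# E"
    then obtain p where p: "p \<in> E" "a = z \<otimes> p" by (auto simp: l_coset_def)
    then have "t \<otimes> a = z \<otimes> (t \<otimes> p)" using EE z t Dc by (simp add: m_ac subset_iff)
    then show "t \<otimes> a \<in> z <# E"
      using p t subalgebraE(4)[OF EE(1)] by (auto simp: l_coset_def)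
  qed
  moreover obtain e where "e \<in> E" "e \<noteq> \<zero>" using EE by auto
  then have "z \<otimes> e \<in> z <# E" "z \<otimes> e \<noteq> \<zero>"
    using z EE integral by (auto simp: l_coset_def)
  ultimately show ?thesis by (auto simp: nonzero_submodules_def)
qed

lemma nonzero_submodules_extension:
  assumes D: "subring D R" and T: "overring R D T" and E: "E \<in> nonzero_submodules R D"
  shows "E \<cdot> T \<in> nonzero_submodules R D" and "subalgebra T (E \<cdot> T) R"
proof -
  have TT: "subring T R" "D \<subseteq> T" using T by (auto simp: overring_def)
  note EE = nonzero_submodulesE[OF E]
  show *: "subalgebra T (E \<cdot> T) R"
    using EE by (intro subalgebra_ideal_prod subalgebra_self TT) auto
  show "E \<cdot> T \<in> nonzero_submodules R D"
    using subalgebra_mono[OF * TT(2)] subset_extension[OF TT(1) EE(2)] EE(3)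
    by (auto simp: nonzero_submodules_def)
qed

lemma semistar_operation_wedge_overring:
  assumes D: "subring D R" and T: "overring R D T"
  shows "semistar_operation R D (wedge_overring R D T)"
proof -
  have TT: "subring T R" "T \<subseteq> carrier R" using T subringE(1) by (auto simp: overring_def)
  note ext = nonzero_submodules_extension[OF D T]
  have "(E \<cdot> T) \<cdot> T = E \<cdot> T" if "E \<in> nonzero_submodules R D" for E
    using extension_subsetI[OF TT(1) ext(2)[OF that] order_refl]
      subset_extension[OF TT(1) nonzero_submodulesE(2)[OF ext(1)[OF that]]] by blast
  moreover have "(z <# E) \<cdot> T = z <# (E \<cdot> T)"
    if "E \<in> nonzero_submodules R D" "z \<in> carrier R" for E z
    using l_coset_extension[OF that(2) TT(2) nonzero_submodulesE(2)[OF that(1)]] .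
  moreover have "E \<subseteq> E \<cdot> T" if "E \<in> nonzero_submodules R D" for E
    using subset_extension[OF TT(1) nonzero_submodulesE(2)[OF that]] .
  moreover have "wedge_overring R D T \<in> nonzero_submodules R D \<rightarrow>\<^sub>E nonzero_submodules R D"
    using ext(1) by (auto simp: wedge_overring_def)
  ultimately show ?thesis
    using ext(1) nonzero_submodules_l_coset[OF D] ideal_prod_mono[of _ _ T T R]
    unfolding semistar_operation_def by (simp add: wedge_overring_def)
qed

text \<open>
  An element of \<open>E T\<close> is a finite sum of products and therefore involves only finitely many elements
  of \<open>E\<close>; these generate the required \<open>F\<close>.
\<close>
lemma finite_type_wedge_overring:
  assumes D: "quotient_field R D" and T: "overring R D T"
  shows "finite_type R D (wedge_overring R D T)"
  unfolding finite_type_def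
proof (intro ballI equalityI subsetI)
  have DD: "subring D R" using D by (simp add: quotient_field_def subdomain_def subcring_def)
  fix E x assume E: "E \<in> nonzero_submodules R D"
  note EE = nonzero_submodulesE[OF E]
  obtain e where e: "e \<in> E" "e \<noteq> \<zero>" using EE by auto
  assume "x \<in> wedge_overring R D T E"
  then have "x \<in> E \<cdot> T" using E by (simp add: wedge_overring_def)
  then have "\<exists>S. finite S \<and> S \<subseteq> E \<and> x \<in> gen_submodule R D S \<cdot> T"
  proof induction
    case (prod i j)
    then show ?case by (intro exI[of _ "{i}"]) (auto intro!: ideal_prod.prod hull_inc)
  next
    case (sum a b)
    then obtain A B where AB: "finite A" "A \<subseteq> E" "a \<in> gen_submodule R D A \<cdot> T"
      "finite B" "B \<subseteq> E" "b \<in> gen_submodule R D B \<cdot> T" by auto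
    have "gen_submodule R D A \<cdot> T \<subseteq> gen_submodule R D (A \<union> B) \<cdot> T"
      "gen_submodule R D B \<cdot> T \<subseteq> gen_submodule R D (A \<union> B) \<cdot> T"
      by (intro ideal_prod_mono hull_mono; simp)+
    then show ?case using AB by (intro exI[of _ "A \<union> B"]) (auto intro: ideal_prod.sum)
  qed
  then obtain S where S: "finite S" "S \<subseteq> E" "x \<in> gen_submodule R D S \<cdot> T" by auto
  \<comment> \<open>The nonzero element \<open>e\<close> of \<open>E\<close> is adjoined because \<open>S\<close> may generate the zero module.\<close>
  define F where "F = gen_submodule R D (insert e S)"
  have F: "F \<in> fg_fractional_ideals R D"
    unfolding F_def using S EE e by (intro gen_submodule_fg_fractional_ideal[OF D]) auto
  have "F \<subseteq> E" unfolding F_def using S e by (intro hull_minimal EE(1)) auto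
  moreover have "x \<in> F \<cdot> T"
    using S(3) ideal_prod_mono[OF hull_mono[of S "insert e S"] order_refl] unfolding F_def by blast
  then have "x \<in> wedge_overring R D T F"
    using fg_fractional_ideal_nonzero_submodule[OF F] by (simp add: wedge_overring_def)
  ultimately show "x \<in> \<Union>{wedge_overring R D T F | F. F \<subseteq> E \<and> F \<in> fg_fractional_ideals R D}"
    using F by blast
next
  fix E x assume E: "E \<in> nonzero_submodules R D"
    and "x \<in> \<Union>{wedge_overring R D T F | F. F \<subseteq> E \<and> F \<in> fg_fractional_ideals R D}"
  then obtain F where F: "F \<subseteq> E" "F \<in> fg_fractional_ideals R D" "x \<in> wedge_overring R D T F"
    by blast
  then show "x \<in> wedge_overring R D T E"
    using E fg_fractional_ideal_nonzero_submodule[OF F(2)] ideal_prod_mono[OF F(1) order_refl]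
    by (auto simp: wedge_overring_def)
qed

end

section \<open>Invertibility of \<open>T + T x\<close>\<close>

text \<open>
  The condition says that \<open>T + T x\<close> is invertible, its inverse being generated by \<open>u\<close> and \<open>r\<close>.
  Keeping these two witnesses makes it usable without computing with ideals.
\<close>
definition pairs_invertible :: "('a, 'b) ring_scheme \<Rightarrow> 'a set \<Rightarrow> bool" where
  "pairs_invertible R T \<longleftrightarrow>
     (\<forall>x\<in>carrier R. \<exists>u\<in>T. \<exists>r\<in>T. u \<otimes>\<^bsub>R\<^esub> x \<in> T \<and> r \<otimes>\<^bsub>R\<^esub> x \<in> T \<and>
        u \<oplus>\<^bsub>R\<^esub> r \<otimes>\<^bsub>R\<^esub> x = \<one>\<^bsub>R\<^esub>)"

context field
begin

text \<open>
  Cancellation in terms of generators: from \<open>(S) a \<subseteq> (S) (B)\<close> one concludes that \<open>a\<close> lies in the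
  \<open>T\<close>-module generated by \<open>B\<close>. The inclusion is phrased as "every \<open>T\<close>-module \<open>M\<close> that contains all
  products \<open>s b\<close> contains all \<open>s a\<close>", which can be checked by exhibiting \<open>s a\<close> as a combination of
  such products.
\<close>
lemma eab_wedge_overring_cancel:
  assumes D: "quotient_field R D" and T: "overring R D T"
    and eab: "eab R D (wedge_overring R D T)"
    and S: "finite S" "S \<subseteq> carrier R" "\<not> S \<subseteq> {\<zero>}"
    and a: "a \<in> carrier R" "a \<noteq> \<zero>"
    and B: "finite B" "B \<subseteq> carrier R" "\<not> B \<subseteq> {\<zero>}"
    and N: "subalgebra T N R" "B \<subseteq> N"
    and incl: "\<And>M s. subalgebra T M R \<Longrightarrow> (\<And>s b. s \<in> S \<Longrightarrow> b \<in> B \<Longrightarrow> s \<otimes> b \<in> M) \<Longrightarrow>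
                 s \<in> S \<Longrightarrow> s \<otimes> a \<in> M"
  shows "a \<in> N"
proof -
  have DD: "subring D R" using D by (simp add: quotient_field_def subdomain_def subcring_def)
  have TT: "subring T R" "D \<subseteq> T" using T by (auto simp: overring_def)
  let ?F = "gen_submodule R D S" and ?G = "gen_submodule R D {a}" and ?H = "gen_submodule R D B"
  have fg: "?F \<in> fg_fractional_ideals R D" "?G \<in> fg_fractional_ideals R D"
    "?H \<in> fg_fractional_ideals R D"
    using S a B by (auto intro!: gen_submodule_fg_fractional_ideal[OF D])
  note nz = fg[THEN fg_fractional_ideal_nonzero_submodule]
  have FG: "?F \<cdot> ?G \<in> nonzero_submodules R D" and FH: "?F \<cdot> ?H \<in> nonzero_submodules R D"
    using nz by (auto intro: nonzero_submodules_prod[OF DD])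
  note M = nonzero_submodules_extension(2)[OF DD T FH]
  have "s \<otimes> b \<in> (?F \<cdot> ?H) \<cdot> T" if "s \<in> S" "b \<in> B" for s b
    using that subset_extension[OF TT(1) nonzero_submodulesE(2)[OF FH]]
    by (auto intro: hull_inc ideal_prod.prod)
  then have "s \<otimes> a \<in> (?F \<cdot> ?H) \<cdot> T" if "s \<in> S" for s
    using incl[OF M] that by blast
  then have "?F \<cdot> ?G \<subseteq> (?F \<cdot> ?H) \<cdot> T"
    using S a by (intro gen_submodule_prod_subset[OF DD subalgebra_mono[OF M TT(2)]]) auto
  then have "(?F \<cdot> ?G) \<cdot> T \<subseteq> (?F \<cdot> ?H) \<cdot> T" by (rule extension_subsetI[OF TT(1) M])
  then have "wedge_overring R D T (?F \<cdot> ?G) \<subseteq> wedge_overring R D T (?F \<cdot> ?H)"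
    using FG FH by (simp add: wedge_overring_def)
  then have "wedge_overring R D T ?G \<subseteq> wedge_overring R D T ?H"
    using eab fg unfolding eab_def by blast
  then have "?G \<cdot> T \<subseteq> ?H \<cdot> T" using nz by (simp add: wedge_overring_def)
  moreover have "?H \<cdot> T \<subseteq> N"
    using N(2) by (intro extension_subsetI[OF TT(1) N(1)] hull_minimal subalgebra_mono[OF N(1) TT(2)])
  moreover have "a \<in> ?G \<cdot> T"
    using subset_extension[OF TT(1) nonzero_submodulesE(2)[OF nz(2)]] by (auto intro: hull_inc)
  ultimately show ?thesis by blast
qed

text \<open>
  The two cancellations replace the classical detour through integral closedness: the only integral
  equation that occurs is the quadratic one for \<open>v = r x\<close>.
\<close>
lemma eab_imp_pairs_invertible:
  assumes D: "quotient_field R D" and T: "overring R D T"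
    and eab: "eab R D (wedge_overring R D T)"
  shows "pairs_invertible R T"
  unfolding pairs_invertible_def
proof
  have TT: "subring T R" "T \<subseteq> carrier R" using T subringE(1) by (auto simp: overring_def)
  note Tm = subringE[OF TT(1)]
  fix x assume x: "x \<in> carrier R"
  show "\<exists>u\<in>T. \<exists>r\<in>T. u \<otimes> x \<in> T \<and> r \<otimes> x \<in> T \<and> u \<oplus> r \<otimes> x = \<one>"
  proof (cases "x = \<zero>")
    case True
    then show ?thesis using Tm(2,3) by (intro bexI[of _ \<one>] bexI[of _ \<zero>]) auto
  next
    case x0: False
    define N where "N = {\<one> \<otimes> p \<oplus> (x \<otimes> x) \<otimes> q | p q. p \<in> T \<and> q \<in> T}"
    have N: "subalgebra T N R" unfolding N_def
      using x by (intro subalgebra_two_gen[OF TT(1) subalgebra_self[OF TT(1)]]) auto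
    \<comment> \<open>\<open>(1, x) (x) = (x, x\<^sup>2)\<close> is contained in \<open>(1, x) (1, x\<^sup>2)\<close>.\<close>
    have "x \<in> N"
    proof (rule eab_wedge_overring_cancel[OF D T eab, where S = "{\<one>, x}" and B = "{\<one>, x \<otimes> x}"])
      have "\<one> = \<one> \<otimes> \<one> \<oplus> (x \<otimes> x) \<otimes> \<zero>" "x \<otimes> x = \<one> \<otimes> \<zero> \<oplus> (x \<otimes> x) \<otimes> \<one>" using x by auto
      then show "{\<one>, x \<otimes> x} \<subseteq> N" unfolding N_def using Tm(2,3) by blast
      fix M s assume M: "\<And>s b. s \<in> {\<one>, x} \<Longrightarrow> b \<in> {\<one>, x \<otimes> x} \<Longrightarrow> s \<otimes> b \<in> M" and s: "s \<in> {\<one>, x}"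
      have "\<one> \<otimes> x \<in> M" "x \<otimes> x \<in> M" using M[of x \<one>] M[of \<one> "x \<otimes> x"] x by auto
      then show "s \<otimes> x \<in> M" using s by auto
    qed (use x x0 N in auto)
    then obtain s r where sr: "s \<in> T" "r \<in> T" "x = s \<oplus> (x \<otimes> x) \<otimes> r"
      using TT(2) unfolding N_def by (auto simp: subset_iff)
    define v where "v = r \<otimes> x"
    have c: "s \<in> carrier R" "r \<in> carrier R" "v \<in> carrier R" using sr TT x by (auto simp: v_def)
    have xs: "x = s \<oplus> v \<otimes> x" using sr(3) c x by (simp add: v_def m_ac)
    have "r \<otimes> x = r \<otimes> (s \<oplus> v \<otimes> x)" using xs by simp
    also have "\<dots> = r \<otimes> s \<oplus> v \<otimes> (r \<otimes> x)" using c x by (simp add: r_distr m_lcomm)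
    finally have v: "v = r \<otimes> s \<oplus> v \<otimes> v" by (simp add: v_def)
    have vv: "v \<otimes> v = v \<oplus> \<ominus> (r \<otimes> s)"
    proof -
      have "v \<oplus> \<ominus> (r \<otimes> s) = (v \<otimes> v \<oplus> r \<otimes> s) \<oplus> \<ominus> (r \<otimes> s)" 
        using v c by (metis a_comm m_closed)
      then show ?thesis using c by (simp add: a_assoc r_neg)
    qed
    \<comment> \<open>By the quadratic equation, \<open>T + T v\<close> is stable under multiplication by \<open>v\<close>.\<close>
    have vT: "v \<in> T"
    proof (cases "v = \<zero>")
      case v0: False
      show ?thesis
      proof (rule eab_wedge_overring_cancel[OF D T eab, where S = "{\<one>, v}" and B = "{\<one>}"])
        fix M s' assume M: "subalgebra T M R" "\<And>s b. s \<in> {\<one>, v} \<Longrightarrow> b \<in> {\<one>} \<Longrightarrow> s \<otimes> b \<in> M"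
          and s': "s' \<in> {\<one>, v}"
        have "\<one> \<in> M" "v \<in> M" using M(2)[of \<one> \<one>] M(2)[of v \<one>] c by auto
        moreover have "\<ominus> (r \<otimes> s) \<in> M"
          using subalgebraE(4)[OF M(1) Tm(5)[OF Tm(6)[OF sr(2,1)]] \<open>\<one> \<in> M\<close>] c by simp
        ultimately have "v \<otimes> v \<in> M" using vv subalgebraE(3)[OF M(1)] by metis
        then show "s' \<otimes> v \<in> M" using s' \<open>v \<in> M\<close> c by auto
      qed (use c v0 Tm in \<open>auto intro: subalgebra_self TT\<close>)
    qed (use Tm in auto)
    define u where "u = \<one> \<oplus> \<ominus> v"
    have uc: "u \<in> carrier R" using c by (simp add: u_def)
    have "u \<in> T" using Tm vT by (simp add: u_def)
    moreover have "u \<otimes> x = s"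
    proof -
      have "u \<otimes> x = x \<oplus> \<ominus> (v \<otimes> x)" using c x by (simp add: u_def l_distr l_minus)
      also have "\<dots> = (s \<oplus> v \<otimes> x) \<oplus> \<ominus> (v \<otimes> x)" using xs by simp
      finally show ?thesis using c x by (simp add: a_assoc r_neg)
    qed
    moreover have "u \<oplus> r \<otimes> x = \<one>"
      using c by (simp add: u_def v_def[symmetric] a_assoc l_neg)
    ultimately show ?thesis using sr vT unfolding v_def by metis
  qed
qed

section \<open>Localization at a maximal ideal\<close>

text \<open>
  \<open>T\<close>-submodules of \<open>T\<close> are its ideals, so this is the existence of a maximal ideal above a proper
  one. Maximality is recorded in the form in which it is used: modulo \<open>M\<close>, each \<open>s \<notin> M\<close> is
  invertible.
\<close>
lemma maximal_proper_submodule: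
  assumes T: "subring T R" and A: "subalgebra T A R" "A \<subseteq> T" "\<one> \<notin> A"
  obtains M where "subalgebra T M R" "A \<subseteq> M" "M \<subseteq> T" "\<one> \<notin> M"
    "\<And>s. s \<in> T \<Longrightarrow> s \<notin> M \<Longrightarrow> \<exists>m\<in>M. \<exists>t\<in>T. m \<oplus> s \<otimes> t = \<one>"
proof -
  define P where "P = {M. subalgebra T M R \<and> A \<subseteq> M \<and> M \<subseteq> T \<and> \<one> \<notin> M}"
  have Tc: "T \<subseteq> carrier R" using subringE(1)[OF T] .
  have "\<exists>M\<in>P. \<forall>B\<in>P. M \<subseteq> B \<longrightarrow> B = M"
  proof (rule subset_Zorn_nonempty)
    show "P \<noteq> {}" using A by (auto simp: P_def)
    fix C assume C: "C \<noteq> {}" "subset.chain P C"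
    then have CP: "C \<subseteq> P" and lin: "\<And>B B'. B \<in> C \<Longrightarrow> B' \<in> C \<Longrightarrow> B \<subseteq> B' \<or> B' \<subseteq> B"
      by (auto simp: subset_chain_def)
    have "subalgebra T (\<Union>C) R"
    proof (rule subalgebraI[OF T])
      show "\<Union>C \<subseteq> carrier R" using CP Tc by (auto simp: P_def)
      show "\<zero> \<in> \<Union>C" using C(1) CP subalgebraE(2) by (force simp: P_def)
      show "a \<oplus> b \<in> \<Union>C" if "a \<in> \<Union>C" "b \<in> \<Union>C" for a b
      proof -
        obtain B where "B \<in> C" "a \<in> B" "b \<in> B" using \<open>a \<in> \<Union>C\<close> \<open>b \<in> \<Union>C\<close> lin by blast
        then have "a \<oplus> b \<in> B" using CP by (intro subalgebraE(3)[of T B R]) (auto simp: P_def)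
        then show ?thesis using \<open>B \<in> C\<close> by blast
      qed
      show "t \<otimes> a \<in> \<Union>C" if "t \<in> T" "a \<in> \<Union>C" for t a
        using that CP subalgebraE(4)[of T _ R] by (force simp: P_def)
    qed
    then show "\<Union>C \<in> P" using C(1) CP by (auto simp: P_def)
  qed
  then obtain M where M: "M \<in> P" "\<And>B. B \<in> P \<Longrightarrow> M \<subseteq> B \<Longrightarrow> B = M" by blast
  then have M': "subalgebra T M R" "A \<subseteq> M" "M \<subseteq> T" "\<one> \<notin> M" by (auto simp: P_def)
  have "\<exists>m\<in>M. \<exists>t\<in>T. m \<oplus> s \<otimes> t = \<one>" if s: "s \<in> T" "s \<notin> M" for s
  proof -
    define B where "B = {m \<oplus> s \<otimes> t | m t. m \<in> M \<and> t \<in> T}"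
    note ME = subalgebraE[OF M'(1)] and TE = subringE[OF T]
    have Balg: "subalgebra T B R"
    proof (rule subalgebraI[OF T])
      have "m \<oplus> s \<otimes> t \<in> carrier R" if "m \<in> M" "t \<in> T" for m t
        using subsetD[OF ME(1) that(1)] subsetD[OF Tc that(2)] subsetD[OF Tc s(1)] by simp
      then show "B \<subseteq> carrier R" by (auto simp: B_def)
      have "\<zero> = \<zero> \<oplus> s \<otimes> \<zero>" using s Tc by auto
      then show "\<zero> \<in> B" using ME TE by (auto simp: B_def)
      fix a b assume "a \<in> B" "b \<in> B"
      then obtain m t m' t' where mt: "a = m \<oplus> s \<otimes> t" "b = m' \<oplus> s \<otimes> t'"
        "m \<in> M" "m' \<in> M" "t \<in> T" "t' \<in> T" by (auto simp: B_def)
      then have "m \<in> carrier R" "m' \<in> carrier R" "t \<in> carrier R" "t' \<in> carrier R" "s \<in> carrier R"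
        using ME(1) Tc s by auto
      then have "a \<oplus> b = (m \<oplus> m') \<oplus> s \<otimes> (t \<oplus> t')" by (simp add: mt r_distr a_ac)
      moreover have "m \<oplus> m' \<in> M" "t \<oplus> t' \<in> T" using ME(3) TE(7) mt by auto
      ultimately show "a \<oplus> b \<in> B" unfolding B_def by blast
    next
      fix w a assume w: "w \<in> T" "a \<in> B"
      then obtain m t where mt: "a = m \<oplus> s \<otimes> t" "m \<in> M" "t \<in> T" by (auto simp: B_def)
      then have "m \<in> carrier R" "t \<in> carrier R" "s \<in> carrier R" "w \<in> carrier R"
        using ME(1) Tc s w by auto
      then have "w \<otimes> a = w \<otimes> m \<oplus> s \<otimes> (w \<otimes> t)" by (simp add: mt r_distr m_ac)
      moreover have "w \<otimes> m \<in> M" "w \<otimes> t \<in> T" using ME(4) TE(6) mt w by auto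
      ultimately show "w \<otimes> a \<in> B" unfolding B_def by blast
    qed
    have "M \<subseteq> B"
    proof
      fix m assume m: "m \<in> M"
      have "m = m \<oplus> s \<otimes> \<zero>" using subsetD[OF ME(1) m] subsetD[OF Tc s(1)] by simp
      then show "m \<in> B" using m TE(2) unfolding B_def by blast
    qed
    have "s = \<zero> \<oplus> s \<otimes> \<one>" using s Tc by auto
    then have "s \<in> B" using ME(2) TE(3) unfolding B_def by blast
    have "B \<subseteq> T" using M'(3) TE(6,7) s(1) by (auto simp: B_def)
    have "B \<notin> P" using M(2) \<open>M \<subseteq> B\<close> \<open>s \<in> B\<close> s by blast
    then have "\<one> \<in> B" using Balg \<open>M \<subseteq> B\<close> M'(2) \<open>B \<subseteq> T\<close> by (auto simp: P_def)
    then obtain m t where "m \<in> M" "t \<in> T" "\<one> = m \<oplus> s \<otimes> t" unfolding B_def by blast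
    then show ?thesis by metis
  qed
  then show ?thesis using that M' by blast
qed

text \<open>
  The ring \<open>V\<close> is the localization of \<open>T\<close> at a maximal ideal \<open>M\<close> above \<open>{t \<in> T. t x \<in> E}\<close>. No
  denominator outside \<open>M\<close> carries \<open>x\<close> into \<open>E\<close>, so \<open>x\<close> stays outside \<open>E V\<close>. The last property,
  that elements of \<open>V\<close> are fractions with numerator in \<open>T\<close> and a denominator that is a unit of
  \<open>V\<close>, is what allows finitely many elements of \<open>V\<close> to be brought back into \<open>T\<close>.
\<close>
lemma exists_valuation_overring_avoiding:
  assumes T: "subring T R" and P: "pairs_invertible R T"
    and E: "subalgebra T E R" and x: "x \<in> carrier R" "x \<notin> E"
  obtains V where "V \<in> Zar R T" "x \<notin> E \<cdot> V"
    "\<And>v. v \<in> V \<Longrightarrow> \<exists>s\<in>T. s \<noteq> \<zero> \<and> inv s \<in> V \<and> s \<otimes> v \<in> T"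
proof -
  note TE = subringE[OF T] and EE = subalgebraE[OF E]
  define A where "A = {t \<in> T. t \<otimes> x \<in> E}"
  have "subalgebra T A R"
    using TE EE x by (intro subalgebraI[OF T]) (auto simp: A_def l_distr m_assoc subset_iff)
  moreover have "A \<subseteq> T" "\<one> \<notin> A" using x by (auto simp: A_def)
  ultimately obtain M where M: "subalgebra T M R" "A \<subseteq> M" "M \<subseteq> T" "\<one> \<notin> M"
    and max: "\<And>s. s \<in> T \<Longrightarrow> s \<notin> M \<Longrightarrow> \<exists>m\<in>M. \<exists>t\<in>T. m \<oplus> s \<otimes> t = \<one>"
    using maximal_proper_submodule[OF T] by metis
  note ME = subalgebraE[OF M(1)]
  have prime: "s \<otimes> s' \<in> T - M" if s: "s \<in> T - M" and s': "s' \<in> T - M" for s s'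
  proof -
    have "s \<otimes> s' \<notin> M"
    proof
      assume ss: "s \<otimes> s' \<in> M"
      obtain m t where mt: "m \<in> M" "t \<in> T" "m \<oplus> s \<otimes> t = \<one>" using max s by blast
      have c: "m \<in> carrier R" "t \<in> carrier R" "s \<in> carrier R" "s' \<in> carrier R"
        using mt s s' TE(1) ME(1) by auto
      have "s' = (m \<oplus> s \<otimes> t) \<otimes> s'" using mt c by simp
      also have "\<dots> = s' \<otimes> m \<oplus> t \<otimes> (s \<otimes> s')" using c by (subst l_distr) (simp_all add: m_ac)
      also have "\<dots> \<in> M" using ME ss mt s' by blast
      finally show False using s' by simp
    qed
    then show ?thesis using TE s s' by blast
  qed
  have S: "s \<in> carrier R" "s \<noteq> \<zero>" if "s \<in> T - M" for s using that TE(1) ME(2) by auto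
  have one: "\<one> \<in> T - M" using TE M by auto
  \<comment> \<open>Describing fractions by a denominator that clears them, instead of as quotients, keeps
      inverses out of the computations and applies to \<open>T\<close> and to \<open>E\<close> alike.\<close>
  define loc where "loc N = {y \<in> carrier R. \<exists>s\<in>T - M. s \<otimes> y \<in> N}" for N
  have loc_add: "a \<oplus> b \<in> loc N" if N: "subalgebra T N R" and ab: "a \<in> loc N" "b \<in> loc N" for a b N
  proof -
    obtain s s' where s: "s \<in> T - M" "s \<otimes> a \<in> N" "s' \<in> T - M" "s' \<otimes> b \<in> N"
      and c: "a \<in> carrier R" "b \<in> carrier R" using ab by (auto simp: loc_def)
    have "(s \<otimes> s') \<otimes> (a \<oplus> b) = s' \<otimes> (s \<otimes> a) \<oplus> s \<otimes> (s' \<otimes> b)"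
      using S s c by (simp add: r_distr m_ac)
    also have "\<dots> \<in> N" using subalgebraE[OF N] s by blast
    finally show ?thesis using prime s c unfolding loc_def by blast
  qed
  have loc_mult: "a \<otimes> b \<in> loc N" if N: "subalgebra T N R" and ab: "a \<in> loc N" "b \<in> loc T" for a b N
  proof -
    obtain s s' where s: "s \<in> T - M" "s \<otimes> a \<in> N" "s' \<in> T - M" "s' \<otimes> b \<in> T"
      and c: "a \<in> carrier R" "b \<in> carrier R" using ab by (auto simp: loc_def)
    have "(s \<otimes> s') \<otimes> (a \<otimes> b) = (s' \<otimes> b) \<otimes> (s \<otimes> a)"
      using S s c by (simp add: m_ac)
    also have "\<dots> \<in> N" using subalgebraE[OF N] s by blast
    finally show ?thesis using prime s c unfolding loc_def by blast
  qed
  note self = subalgebra_self[OF T]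
  have loc_incl: "N \<subseteq> loc N" if "N \<subseteq> carrier R" for N
    using that one by (force simp: loc_def)
  have V: "subring (loc T) R"
  proof (rule subringI)
    show "\<ominus> h \<in> loc T" if h: "h \<in> loc T" for h
      using that TE(5) S by (force simp: loc_def r_minus)
  qed (use loc_add[OF self] loc_mult[OF self] loc_incl[OF TE(1)] TE(3) in \<open>auto simp: loc_def\<close>)
  have "valuation_domain R (loc T)"
    unfolding valuation_domain_def
  proof (intro conjI ballI)
    show "subdomain (loc T) R" using V by (rule subdomainI')
    fix y assume "y \<in> carrier R - {\<zero>}"
    then have y: "y \<in> carrier R" "y \<noteq> \<zero>" by auto
    then obtain u r where ur: "u \<in> T" "r \<in> T" "u \<otimes> y \<in> T" "r \<otimes> y \<in> T" "u \<oplus> r \<otimes> y = \<one>"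
      using P by (auto simp: pairs_invertible_def)
    \<comment> \<open>The sum of the two is \<open>1\<close>, so one of them is an admissible denominator: \<open>u\<close> clears \<open>y\<close>,
        and \<open>r y\<close> clears \<open>1/y\<close>.\<close>
    then have "u \<notin> M \<or> r \<otimes> y \<notin> M" using ME(3) M(4) by metis
    then show "y \<in> loc T \<or> inv y \<in> loc T"
    proof
      assume "u \<notin> M" then show ?thesis using ur y by (auto simp: loc_def)
    next
      assume "r \<otimes> y \<notin> M"
      moreover have "(r \<otimes> y) \<otimes> inv y = r" using inv_nonzero[OF y] y ur TE(1) by (simp add: m_assoc subset_iff)
      ultimately have "r \<otimes> y \<in> T - M" "(r \<otimes> y) \<otimes> inv y \<in> T" using ur by auto
      then show ?thesis using inv_nonzero[OF y] unfolding loc_def by blast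
    qed
  qed
  then have "loc T \<in> Zar R T" using V loc_incl[OF TE(1)] by (auto simp: Zar_def overring_def)
  moreover have "E \<cdot> loc T \<subseteq> loc E"
    using loc_mult[OF E] loc_add[OF E] loc_incl[OF EE(1)] by (intro ideal_prod_subsetI) auto
  moreover have "x \<notin> loc E" using M(2) by (auto simp: loc_def A_def)
  moreover have "\<exists>s\<in>T. s \<noteq> \<zero> \<and> inv s \<in> loc T \<and> s \<otimes> v \<in> T" if v: "v \<in> loc T" for v
  proof -
    obtain s where s: "s \<in> T - M" "s \<otimes> v \<in> T" using v unfolding loc_def by blast
    then have "s \<otimes> inv s \<in> T" "inv s \<in> carrier R" using inv_nonzero[OF S] TE(3) by auto
    then have "inv s \<in> loc T" using s unfolding loc_def by blast
    then show ?thesis using s S by blast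
  qed
  ultimately show ?thesis using that by blast
qed

section \<open>Valuation overrings and the b-operation\<close>

lemma carrier_in_Zar: "subring T R \<Longrightarrow> carrier R \<in> Zar R T"
  using subringE(1)[of T R] carrier_is_subring subdomainI'
  by (auto simp: Zar_def overring_def valuation_domain_def)

lemma Zar_subring: "V \<in> Zar R T \<Longrightarrow> subring V R \<and> T \<subseteq> V"
  by (auto simp: Zar_def overring_def)

lemma wedge_overring_eq_b_operation:
  assumes D: "subring D R" and T: "overring R D T" and P: "pairs_invertible R T"
  shows "wedge_overring R D T = b_operation R D T"
proof
  have TT: "subring T R" using T by (auto simp: overring_def)
  fix E
  show "wedge_overring R D T E = b_operation R D T E"
  proof (cases "E \<in> nonzero_submodules R D")
    case E: True
    have "x \<in> E \<cdot> T" if x: "\<And>V. V \<in> Zar R T \<Longrightarrow> x \<in> E \<cdot> V" for x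
    proof (rule ccontr)
      assume "x \<notin> E \<cdot> T"
      note ET = nonzero_submodules_extension(2)[OF D T E]
      have "E \<cdot> carrier R \<subseteq> carrier R"
        using nonzero_submodulesE(2)[OF E] by (intro ideal_prod_subsetI) auto
      then have "x \<in> carrier R" using x[OF carrier_in_Zar[OF TT]] by auto
      then obtain V where "V \<in> Zar R T" "x \<notin> (E \<cdot> T) \<cdot> V"
        using exists_valuation_overring_avoiding[OF TT P ET _ \<open>x \<notin> E \<cdot> T\<close>] by metis
      moreover have "E \<cdot> V \<subseteq> (E \<cdot> T) \<cdot> V"
        using subset_extension[OF TT nonzero_submodulesE(2)[OF E]] by (rule ideal_prod_mono) auto
      ultimately show False using x by blast
    qed
    moreover have "E \<cdot> T \<subseteq> E \<cdot> V" if "V \<in> Zar R T" for V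
      using Zar_subring[OF that] by (intro ideal_prod_mono) auto
    ultimately have "E \<cdot> T = \<Inter>{E \<cdot> V | V. V \<in> Zar R T}" by blast
    then show ?thesis using E by (simp add: wedge_overring_def b_operation_def)
  qed (simp add: wedge_overring_def b_operation_def)
qed

text \<open>
  Divisibility is total in a valuation domain, so among finitely many elements there is one of least
  value: it divides all the others and generates the same \<open>V\<close>-module as the whole set.
\<close>
lemma valuation_domain_least_value:
  assumes V: "valuation_domain R V"
    and "finite S" "S \<subseteq> carrier R" "\<not> S \<subseteq> {\<zero>}"
  obtains c where "c \<in> S" "c \<noteq> \<zero>" "\<And>s. s \<in> S \<Longrightarrow> s \<otimes> inv c \<in> V"
proof -
  have sub: "subring V R" using V by (simp add: valuation_domain_def subdomain_def subcring_def)
  note VE = subringE[OF sub]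
  have "\<exists>c\<in>S. c \<noteq> \<zero> \<and> (\<forall>s\<in>S. s \<otimes> inv c \<in> V)"
    using assms(2-)
  proof induction
    case (insert a S)
    show ?case
    proof (cases "S \<subseteq> {\<zero>}")
      case True
      then have "a \<in> carrier R" "a \<noteq> \<zero>" using insert by auto
      then show ?thesis using True inv_nonzero[of a] VE by (intro bexI[of _ a]) auto
    next
      case False
      then obtain c where c: "c \<in> S" "c \<noteq> \<zero>" "\<forall>s\<in>S. s \<otimes> inv c \<in> V" using insert by auto
      have cc: "c \<in> carrier R" "a \<in> carrier R" using c insert by auto
      note ic = inv_nonzero[OF cc(1) c(2)]
      show ?thesis
      proof (cases "a \<otimes> inv c \<in> V")
        case True then show ?thesis using c by auto
      next
        case False
        then have ne: "a \<otimes> inv c \<noteq> \<zero>" and a0: "a \<noteq> \<zero>" using VE ic by auto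
        note ia = inv_nonzero[OF cc(2) a0]
        have "inv (a \<otimes> inv c) \<in> V" using V False ne cc ic by (auto simp: valuation_domain_def)
        moreover have "inv (a \<otimes> inv c) = c \<otimes> inv a"
        proof (rule comm_inv_char)
          have "a \<otimes> inv c \<otimes> (c \<otimes> inv a) = (a \<otimes> inv a) \<otimes> (inv c \<otimes> c)"
            using cc ia[THEN conjunct1] ic[THEN conjunct1] by (simp only: m_ac m_closed)
          then show "a \<otimes> inv c \<otimes> (c \<otimes> inv a) = \<one>" using ia ic by simp
        qed (use cc ia ic in auto)
        ultimately have ca: "c \<otimes> inv a \<in> V" by simp
        have "s \<otimes> inv a \<in> V" if s: "s \<in> S" for s
        proof -
          have "s \<in> carrier R" using s insert by auto
          then have "(s \<otimes> inv c) \<otimes> (c \<otimes> inv a) = (s \<otimes> inv a) \<otimes> (inv c \<otimes> c)"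
            using cc ia[THEN conjunct1] ic[THEN conjunct1] by (simp only: m_ac m_closed)
          then have "s \<otimes> inv a = (s \<otimes> inv c) \<otimes> (c \<otimes> inv a)" using ic ia \<open>s \<in> carrier R\<close> by simp
          then show ?thesis using c s ca VE by auto
        qed
        then show ?thesis using a0 ia VE by (intro bexI[of _ a]) auto
      qed
    qed
  qed auto
  then show ?thesis using that by blast
qed

text \<open>
  In a valuation overring \<open>V\<close> the extension \<open>F V\<close> is \<open>c V\<close> with \<open>c \<in> F\<close>, and \<open>c\<close> can be divided
  out. Hence \<open>(F G)\<^sup>b \<subseteq> (F H)\<^sup>b\<close> gives \<open>c G \<subseteq> F H V = c H V\<close>, so \<open>G V \<subseteq> H V\<close> for each \<open>V\<close>.
\<close>
lemma eab_b_operation: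
  assumes D: "subring D R" and T: "overring R D T"
  shows "eab R D (b_operation R D T)"
  unfolding eab_def
proof (intro ballI impI)
  fix F G H
  assume fg: "F \<in> fg_fractional_ideals R D" "G \<in> fg_fractional_ideals R D"
      "H \<in> fg_fractional_ideals R D"
    and incl: "b_operation R D T (F \<cdot> G) \<subseteq> b_operation R D T (F \<cdot> H)"
  note nz = fg[THEN fg_fractional_ideal_nonzero_submodule]
  have FG: "F \<cdot> G \<in> nonzero_submodules R D" and FH: "F \<cdot> H \<in> nonzero_submodules R D"
    using nz by (auto intro: nonzero_submodules_prod[OF D])
  have "G \<cdot> V \<subseteq> H \<cdot> V" if V: "V \<in> Zar R T" for V
  proof -
    have VV: "subring V R" "T \<subseteq> V" "D \<subseteq> V" "valuation_domain R V"
      using V T by (auto simp: Zar_def overring_def)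
    then have DV: "overring R D V" by (simp add: overring_def)
    note HV = nonzero_submodules_extension[OF D DV nz(3)]
    note cH = nonzero_submodulesE(2)[OF nz(3)] and cV = subringE(1)[OF VV(1)]
      and cHV = nonzero_submodulesE(2)[OF HV(1)]
    obtain S where S: "finite S" "S \<subseteq> carrier R" "\<not> S \<subseteq> {\<zero>}" "F = gen_submodule R D S"
      using fg_fractional_idealE[OF D fg(1)] .
    obtain c where c: "c \<in> S" "c \<noteq> \<zero>" "\<And>s. s \<in> S \<Longrightarrow> s \<otimes> inv c \<in> V"
      using valuation_domain_least_value[OF VV(4) S(1-3)] by metis
    have cc: "c \<in> carrier R" using c S by auto
    note ic = inv_nonzero[OF cc c(2)]
    have N: "subalgebra V (colon R (H \<cdot> V) {inv c}) R"
      using ic by (intro subalgebra_colon VV HV) auto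
    have F: "F \<subseteq> colon R V {inv c}"
      unfolding S(4) using c S ic
      by (intro hull_minimal subalgebra_mono[OF _ VV(3)] subalgebra_colon VV subalgebra_self)
        (auto simp: colon_def)
    have "F \<cdot> H \<subseteq> colon R (H \<cdot> V) {inv c}"
    proof (rule ideal_prod_subsetI)
      fix f h assume fh: "f \<in> F" "h \<in> H"
      have fc: "f \<in> carrier R" "f \<otimes> inv c \<in> V" using F fh by (auto simp: colon_def)
      have hc: "h \<in> carrier R" using fh cH by auto
      have "f \<otimes> h \<otimes> inv c = h \<otimes> (f \<otimes> inv c)" using fc hc ic by (simp add: m_ac)
      also have "\<dots> \<in> H \<cdot> V" using fh fc by (intro ideal_prod.prod)
      finally show "f \<otimes> h \<in> colon R (H \<cdot> V) {inv c}" using fc hc by (auto simp: colon_def)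
    qed (rule subalgebraE(3)[OF N])
    then have FHV: "(F \<cdot> H) \<cdot> V \<subseteq> colon R (H \<cdot> V) {inv c}"
      by (rule extension_subsetI[OF VV(1) N])
    have "g \<in> H \<cdot> V" if g: "g \<in> G" for g
    proof -
      have gc: "g \<in> carrier R" using g nonzero_submodulesE(2)[OF nz(2)] by auto
      have "c \<otimes> g \<in> F \<cdot> G" using c g S(4) by (auto intro: ideal_prod.prod hull_inc)
      also have "\<dots> \<subseteq> b_operation R D T (F \<cdot> G)"
        using FG subset_extension[of _ "F \<cdot> G"] nonzero_submodulesE(2)[OF FG] Zar_subring
        by (auto simp: b_operation_def)
      also have "\<dots> \<subseteq> b_operation R D T (F \<cdot> H)" by (rule incl)
      also have "\<dots> \<subseteq> (F \<cdot> H) \<cdot> V" using FH V by (auto simp: b_operation_def)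
      also note FHV
      finally have "c \<otimes> g \<otimes> inv c \<in> H \<cdot> V" by (auto simp: colon_def)
      moreover have "c \<otimes> g \<otimes> inv c = g \<otimes> (c \<otimes> inv c)" using gc cc ic[THEN conjunct1] by (simp only: m_ac m_closed)
      ultimately show ?thesis using ic gc by simp
    qed
    then show ?thesis by (intro extension_subsetI[OF VV(1) HV(2)]) auto
  qed
  then show "b_operation R D T G \<subseteq> b_operation R D T H"
    using nz by (fastforce simp: b_operation_def)
qed

section \<open>Pruefer domains\<close>

text \<open>
  The ideals of \<open>T\<close> are the \<open>T\<close>-submodules of \<open>K\<close> inside \<open>T\<close>; this transfers ideals generated in the
  ring \<open>T\<close> to modules generated in the ambient field.
\<close>
lemma genideal_eq_gen_submodule:
  assumes T: "subring T R" and S: "S \<subseteq> T"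
  shows "Idl\<^bsub>R\<lparr>carrier := T\<rparr>\<^esub> S = gen_submodule R T S"
proof -
  interpret T: ring "R\<lparr>carrier := T\<rparr>" by (rule subring_is_ring[OF T])
  note TE = subringE[OF T]
  let ?I = "Idl\<^bsub>R\<lparr>carrier := T\<rparr>\<^esub> S"
  have I: "ideal ?I (R\<lparr>carrier := T\<rparr>)" by (rule T.genideal_ideal) (use S in simp)
  have "subalgebra T ?I R"
  proof (rule subalgebraI[OF T])
    show "?I \<subseteq> carrier R" using ideal.Icarr[OF I] TE(1) by auto
    show "\<zero> \<in> ?I" using additive_subgroup.zero_closed[OF ideal.axioms(1)[OF I]] by simp
    show "a \<oplus> b \<in> ?I" if "a \<in> ?I" "b \<in> ?I" for a b
      using additive_subgroup.a_closed[OF ideal.axioms(1)[OF I] that] by simp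
    show "t \<otimes> a \<in> ?I" if "t \<in> T" "a \<in> ?I" for t a
      using ideal.I_l_closed[OF I that(2), of t] that(1) by simp
  qed
  moreover have "S \<subseteq> ?I" using T.genideal_self[of S] S by simp
  ultimately have "gen_submodule R T S \<subseteq> ?I" by (intro hull_minimal)
  moreover have "?I \<subseteq> gen_submodule R T S"
  proof (rule T.genideal_minimal)
    have G: "subalgebra T (gen_submodule R T S) R"
      using S TE(1) by (intro subalgebra_gen_submodule[OF T]) auto
    have GT: "gen_submodule R T S \<subseteq> T" using S by (intro hull_minimal subalgebra_self[OF T])
    show "ideal (gen_submodule R T S) (R\<lparr>carrier := T\<rparr>)"
    proof (rule idealI)
      show "ring (R\<lparr>carrier := T\<rparr>)" by (rule T.ring_axioms)
      have "subgroup (gen_submodule R T S) (add_monoid R)" using G by (simp add: subalgebra_def)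
      then have "subgroup (gen_submodule R T S) ((add_monoid R)\<lparr>carrier := T\<rparr>)"
        using T GT by (intro add.subgroup_incl) (simp_all add: subring_def)
      then show "subgroup (gen_submodule R T S) (add_monoid (R\<lparr>carrier := T\<rparr>))" by simp
    next
      fix a x assume "a \<in> gen_submodule R T S" "x \<in> carrier (R\<lparr>carrier := T\<rparr>)"
      then have ax: "a \<in> gen_submodule R T S" "x \<in> T" by auto
      have "a \<in> carrier R" "x \<in> carrier R" using ax GT TE(1) by blast+
      then have "x \<otimes> a \<in> gen_submodule R T S" "a \<otimes> x = x \<otimes> a"
        using subalgebraE(4)[OF G ax(2,1)] by (auto intro: m_comm)
      then show "x \<otimes>\<^bsub>R\<lparr>carrier := T\<rparr>\<^esub> a \<in> gen_submodule R T S"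
        "a \<otimes>\<^bsub>R\<lparr>carrier := T\<rparr>\<^esub> x \<in> gen_submodule R T S" by simp_all
    qed
    show "S \<subseteq> gen_submodule R T S" by (rule hull_subset)
  qed
  ultimately show ?thesis by blast
qed

text \<open>
  Write \<open>x = a/b\<close> and let \<open>J\<close> be the inverse of \<open>(a, b)\<close>. Then \<open>1 = a p + b q\<close> with \<open>p, q \<in> J\<close>, and
  \<open>u = b q\<close>, \<open>r = b p\<close> are the witnesses, since \<open>u x = a q\<close> and \<open>r x = a p\<close>.
\<close>
lemma prufer_domain_imp_pairs_invertible:
  assumes "prufer_domain R T"
  shows "pairs_invertible R T"
  unfolding pairs_invertible_def
proof
  have Q: "quotient_field R T" using assms by (simp add: prufer_domain_def)
  then have T: "subring T R" by (simp add: quotient_field_def subdomain_def subcring_def)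
  note TE = subringE[OF T]
  fix x assume x: "x \<in> carrier R"
  obtain a b where ab: "a \<in> T" "b \<in> T" "b \<noteq> \<zero>" "x = a \<otimes> inv b"
    using Q x unfolding quotient_field_def by blast
  have c: "a \<in> carrier R" "b \<in> carrier R" using ab TE by auto
  note ib = inv_nonzero[OF c(2) ab(3)]
  let ?I = "gen_submodule R T {a, b}"
  have Idl: "Idl\<^bsub>R\<lparr>carrier := T\<rparr>\<^esub> {a, b} = ?I" using ab by (intro genideal_eq_gen_submodule[OF T]) auto
  have abI: "a \<in> ?I" "b \<in> ?I" by (auto intro: hull_inc)
  then have "?I \<noteq> {\<zero>}" using ab by auto
  then have "invertible_ideal R T ?I"
    using assms ab Idl unfolding prufer_domain_def by (metis bot.extremum finite.emptyI finite_insert insert_subset)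
  then obtain J where J: "subalgebra T J R" "?I \<cdot> J = T"
    by (auto simp: invertible_ideal_def fractional_ideal_def)
  note JE = subalgebraE[OF J(1)]
  define N where "N = {a \<otimes> p \<oplus> b \<otimes> q | p q. p \<in> J \<and> q \<in> J}"
  have N: "subalgebra T N R" unfolding N_def by (rule subalgebra_two_gen[OF T J(1) c])
  have "?I \<subseteq> colon R N J"
  proof (intro hull_minimal subalgebra_colon[OF T N JE(1)] subsetI)
    fix y assume y: "y \<in> {a, b}"
    have "a \<otimes> j \<in> N \<and> b \<otimes> j \<in> N" if "j \<in> J" for j
    proof -
      have "a \<otimes> j = a \<otimes> j \<oplus> b \<otimes> \<zero>" "b \<otimes> j = a \<otimes> \<zero> \<oplus> b \<otimes> j" using that JE c by auto
      then show ?thesis using that JE(2) unfolding N_def by blast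
    qed
    then show "y \<in> colon R N J" using y c by (auto simp: colon_def)
  qed
  then have "?I \<cdot> J \<subseteq> N"
    using subalgebraE(3)[OF N] by (intro ideal_prod_subsetI) (auto simp: colon_def)
  then obtain p q where pq: "p \<in> J" "q \<in> J" "a \<otimes> p \<oplus> b \<otimes> q = \<one>"
    using J(2) TE(3) by (force simp: N_def)
  then have pqc: "p \<in> carrier R" "q \<in> carrier R" using JE by auto
  have IJ: "a \<otimes> p \<in> T" "b \<otimes> p \<in> T" "a \<otimes> q \<in> T" "b \<otimes> q \<in> T"
    using abI pq J(2) ideal_prod.prod[of _ ?I _ J R] by blast+
  have "w \<in> carrier R \<Longrightarrow> b \<otimes> w \<otimes> x = (a \<otimes> w) \<otimes> (b \<otimes> inv b)" for w
    using c ib[THEN conjunct1] by (simp only: ab(4) m_ac m_closed)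
  then have bx: "w \<in> carrier R \<Longrightarrow> b \<otimes> w \<otimes> x = a \<otimes> w" for w using ib c by simp
  have "b \<otimes> q \<oplus> b \<otimes> p \<otimes> x = \<one>" using pq(3) bx pqc c by (simp add: a_comm)
  then show "\<exists>u\<in>T. \<exists>r\<in>T. u \<otimes> x \<in> T \<and> r \<otimes> x \<in> T \<and> u \<oplus> r \<otimes> x = \<one>"
    using IJ bx pqc by (intro bexI[of _ "b \<otimes> q"] bexI[of _ "b \<otimes> p"]) auto
qed

lemma quotient_field_overring:
  assumes "quotient_field R D" "overring R D T"
  shows "quotient_field R T"
  using assms subdomainI'[of T] unfolding quotient_field_def overring_def by blast

text \<open>
  The candidate for the inverse of \<open>I = (S)\<close> is \<open>J = (T : I)\<close>. If \<open>1 \<notin> I J\<close>, pick a localization \<open>V\<close>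
  with \<open>1 \<notin> I J V\<close>. There \<open>I V = c V\<close> with \<open>c \<in> S\<close>; a common denominator \<open>d\<close> of the finitely many
  fractions \<open>s/c\<close> puts \<open>d/c\<close> into \<open>J\<close>, and \<open>d\<close> is a unit of \<open>V\<close>, so \<open>1 = c (d/c) (1/d) \<in> I J V\<close>.
\<close>
lemma pairs_invertible_imp_prufer_domain:
  assumes Q: "quotient_field R T" and P: "pairs_invertible R T"
  shows "prufer_domain R T"
  unfolding prufer_domain_def
proof (intro conjI allI impI)
  have T: "subring T R" using Q by (simp add: quotient_field_def subdomain_def subcring_def)
  note TE = subringE[OF T]
  fix S assume S: "finite S" "S \<subseteq> T" "Idl\<^bsub>R\<lparr>carrier := T\<rparr>\<^esub> S \<noteq> {\<zero>}"
  let ?I = "gen_submodule R T S"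
  have Idl: "Idl\<^bsub>R\<lparr>carrier := T\<rparr>\<^esub> S = ?I" using S by (intro genideal_eq_gen_submodule[OF T])
  have Sc: "S \<subseteq> carrier R" using S TE(1) by auto
  have I: "subalgebra T ?I R" by (rule subalgebra_gen_submodule[OF T Sc])
  note IE = subalgebraE[OF I]
  have "subalgebra T {\<zero>} R" using TE(1) by (intro subalgebraI[OF T]) auto
  then have S0: "\<not> S \<subseteq> {\<zero>}"
    using hull_minimal[of S "{\<zero>}" "\<lambda>M. subalgebra T M R"] IE(2) S(3) Idl by blast
  define J where "J = colon R T ?I"
  have J: "subalgebra T J R" unfolding J_def by (intro subalgebra_colon T subalgebra_self IE)
  note JE = subalgebraE[OF J]
  have "fractional_ideal R T J"
  proof -
    obtain d where "d \<in> S" "d \<noteq> \<zero>" using S0 by auto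
    moreover have "d <# J \<subseteq> T"
    proof -
      have "d \<in> ?I" using \<open>d \<in> S\<close> by (rule hull_inc)
      then have "j \<otimes> d \<in> T \<and> d \<otimes> j = j \<otimes> d" if "j \<in> J" for j
        using that IE(1) by (auto simp: J_def colon_def m_comm)
      then show ?thesis by (auto simp: l_coset_def)
    qed
    ultimately show ?thesis using J S by (auto simp: fractional_ideal_def)
  qed
  moreover have "?I \<cdot> J = T"
  proof
    show "?I \<cdot> J \<subseteq> T"
    proof (rule ideal_prod_subsetI)
      fix i j assume ij: "i \<in> ?I" "j \<in> J"
      then have "j \<otimes> i \<in> T" "i \<otimes> j = j \<otimes> i"
        using IE(1) by (auto simp: J_def colon_def m_comm)
      then show "i \<otimes> j \<in> T" by simp
    qed (rule TE(7))
    have IJ: "subalgebra T (?I \<cdot> J) R"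
      using IE by (intro subalgebra_ideal_prod[OF T _ _ J]) auto
    have "\<one> \<in> ?I \<cdot> J"
    proof (rule ccontr)
      assume "\<one> \<notin> ?I \<cdot> J"
      then obtain V where V: "V \<in> Zar R T" "\<one> \<notin> (?I \<cdot> J) \<cdot> V"
        "\<And>v. v \<in> V \<Longrightarrow> \<exists>s\<in>T. s \<noteq> \<zero> \<and> inv s \<in> V \<and> s \<otimes> v \<in> T"
        using exists_valuation_overring_avoiding[OF T P IJ one_closed] by metis
      have VV: "subring V R" "valuation_domain R V" using V by (auto simp: Zar_def overring_def)
      note VE = subringE[OF VV(1)]
      obtain c where c: "c \<in> S" "c \<noteq> \<zero>" "\<And>s. s \<in> S \<Longrightarrow> s \<otimes> inv c \<in> V"
        using valuation_domain_least_value[OF VV(2) S(1) Sc S0] by metis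
      have cc: "c \<in> carrier R" using c Sc by auto
      note ic = inv_nonzero[OF cc c(2)]
      \<comment> \<open>The product of the individual denominators.\<close>
      have "\<exists>d\<in>T. d \<noteq> \<zero> \<and> inv d \<in> V \<and> (\<forall>s\<in>S. d \<otimes> (s \<otimes> inv c) \<in> T)"
        using S(1) Sc c(3)
      proof induction
        case empty
        then show ?case using TE VE by (intro bexI[of _ \<one>]) auto
      next
        case (insert a S)
        then obtain d where d: "d \<in> T" "d \<noteq> \<zero>" "inv d \<in> V" "\<And>s. s \<in> S \<Longrightarrow> d \<otimes> (s \<otimes> inv c) \<in> T"
          by auto
        obtain e where e: "e \<in> T" "e \<noteq> \<zero>" "inv e \<in> V" "e \<otimes> (a \<otimes> inv c) \<in> T"
          using V(3)[of "a \<otimes> inv c"] insert by auto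
        have dec: "d \<in> carrier R" "e \<in> carrier R" using d e TE by auto
        note id = inv_nonzero[OF dec(1) d(2)] and ie = inv_nonzero[OF dec(2) e(2)]
        have "inv (d \<otimes> e) = inv d \<otimes> inv e"
        proof (rule comm_inv_char)
          have "d \<otimes> e \<otimes> (inv d \<otimes> inv e) = (d \<otimes> inv d) \<otimes> (e \<otimes> inv e)"
            using dec id[THEN conjunct1] ie[THEN conjunct1] by (simp only: m_ac m_closed)
          then show "d \<otimes> e \<otimes> (inv d \<otimes> inv e) = \<one>" using id ie by simp
        qed (use dec id ie in auto)
        moreover have "d \<otimes> e \<otimes> (s \<otimes> inv c) \<in> T" if s: "s \<in> insert a S" for s
        proof -
          define w where "w = s \<otimes> inv c"
          have "w \<in> carrier R" using s insert.prems(1) ic by (auto simp: w_def)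
          then have "d \<otimes> e \<otimes> w = d \<otimes> (e \<otimes> w)" "d \<otimes> e \<otimes> w = e \<otimes> (d \<otimes> w)"
            using dec by (simp_all add: m_assoc m_lcomm)
          moreover have "e \<otimes> w \<in> T \<or> d \<otimes> w \<in> T" using s d(4) e(4) by (auto simp: w_def)
          ultimately have "d \<otimes> e \<otimes> w \<in> T" using TE(6) d(1) e(1) by metis
          then show ?thesis by (simp add: w_def)
        qed
        moreover have "d \<otimes> e \<noteq> \<zero>" using d(2) e(2) dec integral by blast
        ultimately show ?case
          using d(1,3) e(1,3) TE(6) VE(6) by (intro bexI[of _ "d \<otimes> e"]) auto
      qed
      then obtain d where d: "d \<in> T" "d \<noteq> \<zero>" "inv d \<in> V" "\<And>s. s \<in> S \<Longrightarrow> d \<otimes> (s \<otimes> inv c) \<in> T"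
        by auto
      have dc: "d \<in> carrier R" using d TE by auto
      note id = inv_nonzero[OF dc d(2)]
      let ?y = "d \<otimes> inv c"
      have "?I \<subseteq> colon R T {?y}"
      proof (intro hull_minimal subalgebra_colon T subalgebra_self subsetI)
        fix s assume s: "s \<in> S"
        then have "s \<in> carrier R" using Sc by auto
        then have "s \<otimes> ?y = d \<otimes> (s \<otimes> inv c)" using dc ic by (simp add: m_ac)
        then show "s \<in> colon R T {?y}" using d(4)[OF s] \<open>s \<in> carrier R\<close> by (simp add: colon_def)
      qed (use dc ic in auto)
      then have "?y \<in> J"
        using IE(1) dc ic by (auto simp: J_def colon_def m_comm subset_iff)
      then have "(c \<otimes> ?y) \<otimes> inv d \<in> (?I \<cdot> J) \<cdot> V"
        using c d by (intro ideal_prod.prod hull_inc) auto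
      moreover have "(c \<otimes> ?y) \<otimes> inv d = (c \<otimes> inv c) \<otimes> (d \<otimes> inv d)"
        using cc dc ic[THEN conjunct1] id[THEN conjunct1] by (simp only: m_ac m_closed)
      ultimately show False using V(2) ic id by simp
    qed
    then show "T \<subseteq> ?I \<cdot> J" using subalgebraE(4)[OF IJ, of _ \<one>] TE(1) by force
  qed
  ultimately show "invertible_ideal R T (Idl\<^bsub>R\<lparr>carrier := T\<rparr>\<^esub> S)"
    unfolding Idl invertible_ideal_def by blast
qed (rule Q)

end

section \<open>The equivalence\<close>

theorem proposition5p6:
  fixes K :: "('a, 'b) ring_scheme" and D T :: "'a set"
  assumes "quotient_field K D" and "overring K D T"
  shows "(wedge_overring K D T \<in> SStar_f_eab K D \<longleftrightarrow> wedge_overring K D T = b_operation K D T) \<and>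
         (wedge_overring K D T = b_operation K D T \<longleftrightarrow> prufer_domain K T)"
proof -
  interpret field K using assms(1) by (simp add: quotient_field_def)
  have D: "subring D K" using assms(1) by (simp add: quotient_field_def subdomain_def subcring_def)
  let ?i = "wedge_overring K D T \<in> SStar_f_eab K D"
    and ?ii = "wedge_overring K D T = b_operation K D T"
  have "?i \<Longrightarrow> pairs_invertible K T"
    using eab_imp_pairs_invertible[OF assms] by (simp add: SStar_f_eab_def)
  moreover have "pairs_invertible K T \<Longrightarrow> ?ii"
    by (rule wedge_overring_eq_b_operation[OF D assms(2)])
  moreover have "?ii \<Longrightarrow> ?i"
    using semistar_operation_wedge_overring[OF D assms(2)] finite_type_wedge_overring[OF assms]
      eab_b_operation[OF D assms(2)] by (simp add: SStar_f_eab_def)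
  moreover have "pairs_invertible K T \<longleftrightarrow> prufer_domain K T"
    using prufer_domain_imp_pairs_invertible
      pairs_invertible_imp_prufer_domain[OF quotient_field_overring[OF assms]] by blast
  ultimately show ?thesis by blast
qed

end
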